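(* Let $K$ be a finite loopfree category and $G$ a finite group acting on $K$ such that Condition (C) is satisfied. Then $$\mu(K/G)=\frac1{|G|}\sum_{g\in G}\mu(K_g).$$
   Context: For a small category $K$, $\mathcal M(K)$ is its set of morphisms and $\mathcal M_K(x,y)$ the set of morphisms from $x$ to $y$; a morphism $m$ from $a$ to $b$ has $\partial^\bullet m=a$ (source) and $\partial_\bullet m=b$ (target). $K$ is loopfree if for all objects $x\ne y$ at most one of $\mathcal M_K(x,y)$, $\mathcal M_K(y,x)$ is nonempty, and $\mathcal M_K(x,x)=\{\mathrm{id}_x\}$ for all $x$. A group $G$ (viewed as a one-object category) acts on $K$ if there is a functor $\mathcal A_K:G\to\mathbf{Cat}$ ($\mathbf{Cat}$ = category of small categories) sending the unique object to $K$; thus each $g\in G$ acts as an automorphism of $K$. $Gx$ denotes the orbit of $x$. The quotient $K/G$ is the colimit of $\mathcal A_K$ in $\mathbf{Cat}$. $K_g$ is the subcategory of all objects and morphisms of $K$ fixed by $g$. $\Delta(K)$ is the nerve of $K$. For a category $K$ such that $\Delta(K)$ has finitely many (nondegenerate) simplices, the Möbius function of $K$ is $\mu(K)=\tilde\chi(\Delta(K))$, the reduced Euler characteristic ($\tilde\chi=\chi-1$). Condition (C): for every $t\ge 2$, if $m_1,\dots,m_{t-1},m_a,m_b\in\mathcal M(K)$ satisfy $\partial^\bullet m_i=\partial_\bullet m_{i-1}$ for all $2\le i\le t-1$, $\partial^\bullet m_a=\partial^\bullet m_b=\partial_\bullet m_{t-1}$, and $Gm_a=Gm_b$, then there is $g\in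 G$ with $gm_a=m_b$ and $gm_i=m_i$ for $1\le i\le t-1$. *)

theory Defs
  imports Complex_Main "HOL-Algebra.Group"
begin

section \<open>Small categories and functors\<close>

record ('o, 'm) cat =
  Obj :: "'o set"
  Arr :: "'m set"
  Src :: "'m \<Rightarrow> 'o"
  Tgt :: "'m \<Rightarrow> 'o"
  Idt :: "'o \<Rightarrow> 'm"
  Cmp :: "'m \<Rightarrow> 'm \<Rightarrow> 'm"

text \<open>\<open>Cmp K n m\<close> is the composite ``first \<open>m\<close>, then \<open>n\<close>''; it is meaningful
  only if \<open>Src K n = Tgt K m\<close>.\<close>

definition is_category :: "('o, 'm) cat \<Rightarrow> bool" where
  "is_category K \<longleftrightarrow>
     (\<forall>m\<in>Arr K. Src K m \<in> Obj K \<and> Tgt K m \<in> Obj K) \<and>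
     (\<forall>x\<in>Obj K. Idt K x \<in> Arr K \<and> Src K (Idt K x) = x \<and> Tgt K (Idt K x) = x) \<and>
     (\<forall>m\<in>Arr K. \<forall>n\<in>Arr K. Src K n = Tgt K m \<longrightarrow>
        Cmp K n m \<in> Arr K \<and> Src K (Cmp K n m) = Src K m \<and> Tgt K (Cmp K n m) = Tgt K n) \<and>
     (\<forall>m\<in>Arr K. Cmp K m (Idt K (Src K m)) = m \<and> Cmp K (Idt K (Tgt K m)) m = m) \<and>
     (\<forall>l\<in>Arr K. \<forall>m\<in>Arr K. \<forall>n\<in>Arr K. Src K m = Tgt K l \<longrightarrow> Src K n = Tgt K m \<longrightarrow>
        Cmp K n (Cmp K m l) = Cmp K (Cmp K n m) l)"

definition finite_category :: "('o, 'm) cat \<Rightarrow> bool" where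
  "finite_category K \<longleftrightarrow> is_category K \<and> finite (Obj K) \<and> finite (Arr K)"

definition homset :: "('o, 'm) cat \<Rightarrow> 'o \<Rightarrow> 'o \<Rightarrow> 'm set" where
  "homset K x y = {m \<in> Arr K. Src K m = x \<and> Tgt K m = y}"

definition loopfree :: "('o, 'm) cat \<Rightarrow> bool" where
  "loopfree K \<longleftrightarrow>
     (\<forall>x\<in>Obj K. \<forall>y\<in>Obj K. x \<noteq> y \<longrightarrow> homset K x y = {} \<or> homset K y x = {}) \<and>
     (\<forall>x\<in>Obj K. homset K x x = {Idt K x})"

record ('o, 'm, 'p, 'n) cfunctor =
  Fobj :: "'o \<Rightarrow> 'p"
  Farr :: "'m \<Rightarrow> 'n"

definition is_functor ::
    "('o, 'm) cat \<Rightarrow> ('p, 'n) cat \<Rightarrow> ('o, 'm, 'p, 'n) cfunctor \<Rightarrow> bool" where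
  "is_functor K L F \<longleftrightarrow>
     (\<forall>x\<in>Obj K. Fobj F x \<in> Obj L) \<and>
     (\<forall>m\<in>Arr K. Farr F m \<in> Arr L \<and>
        Src L (Farr F m) = Fobj F (Src K m) \<and> Tgt L (Farr F m) = Fobj F (Tgt K m)) \<and>
     (\<forall>x\<in>Obj K. Farr F (Idt K x) = Idt L (Fobj F x)) \<and>
     (\<forall>m\<in>Arr K. \<forall>n\<in>Arr K. Src K n = Tgt K m \<longrightarrow>
        Farr F (Cmp K n m) = Cmp L (Farr F n) (Farr F m))"

text \<open>Since carriers are explicit sets, equality of functors with source \<open>K\<close> is agreement
  on the objects and morphisms of \<open>K\<close>.\<close>

definition functor_eq ::
    "('o, 'm) cat \<Rightarrow> ('o, 'm, 'p, 'n) cfunctor \<Rightarrow> ('o, 'm, 'p, 'n) cfunctor \<Rightarrow> bool" where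
  "functor_eq K F H \<longleftrightarrow>
     (\<forall>x\<in>Obj K. Fobj F x = Fobj H x) \<and> (\<forall>m\<in>Arr K. Farr F m = Farr H m)"

definition id_functor :: "('o, 'm, 'o, 'm) cfunctor" where
  "id_functor = \<lparr>Fobj = (\<lambda>x. x), Farr = (\<lambda>m. m)\<rparr>"

definition comp_functor ::
    "('p, 'n, 'q, 'l) cfunctor \<Rightarrow> ('o, 'm, 'p, 'n) cfunctor \<Rightarrow> ('o, 'm, 'q, 'l) cfunctor" where
  "comp_functor F H = \<lparr>Fobj = Fobj F \<circ> Fobj H, Farr = Farr F \<circ> Farr H\<rparr>"

section \<open>Group actions on categories\<close>

text \<open>A functor from the one-object category \<open>G\<close> to \<open>Cat\<close> sending the unique object to \<open>K\<close>:
  every \<open>g\<close> is sent to an endofunctor \<open>A g\<close> of \<open>K\<close>, and identity and composition are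
  preserved.\<close>

definition category_action ::
    "('g, 'b) monoid_scheme \<Rightarrow> ('o, 'm) cat \<Rightarrow> ('g \<Rightarrow> ('o, 'm, 'o, 'm) cfunctor) \<Rightarrow> bool" where
  "category_action G K A \<longleftrightarrow>
     (\<forall>g\<in>carrier G. is_functor K K (A g)) \<and>
     functor_eq K (A \<one>\<^bsub>G\<^esub>) id_functor \<and>
     (\<forall>g\<in>carrier G. \<forall>h\<in>carrier G.
        functor_eq K (A (g \<otimes>\<^bsub>G\<^esub> h)) (comp_functor (A g) (A h)))"

definition arr_orbit ::
    "('g, 'b) monoid_scheme \<Rightarrow> ('g \<Rightarrow> ('o, 'm, 'o, 'm) cfunctor) \<Rightarrow> 'm \<Rightarrow> 'm set" where
  "arr_orbit G A m = (\<lambda>g. Farr (A g) m) ` carrier G"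

definition fixed_subcategory ::
    "('o, 'm) cat \<Rightarrow> ('o, 'm, 'o, 'm) cfunctor \<Rightarrow> ('o, 'm) cat" where
  "fixed_subcategory K F =
     K\<lparr>Obj := {x \<in> Obj K. Fobj F x = x}, Arr := {m \<in> Arr K. Farr F m = m}\<rparr>"

definition condition_C ::
    "('g, 'b) monoid_scheme \<Rightarrow> ('o, 'm) cat \<Rightarrow> ('g \<Rightarrow> ('o, 'm, 'o, 'm) cfunctor) \<Rightarrow> bool" where
  "condition_C G K A \<longleftrightarrow>
     (\<forall>t\<ge>2. \<forall>(m :: nat \<Rightarrow> 'm) ma mb.
        (\<forall>i\<in>{1..t-1}. m i \<in> Arr K) \<longrightarrow> ma \<in> Arr K \<longrightarrow> mb \<in> Arr K \<longrightarrow>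
        (\<forall>i\<in>{2..t-1}. Src K (m i) = Tgt K (m (i - 1))) \<longrightarrow>
        Src K ma = Tgt K (m (t - 1)) \<longrightarrow> Src K mb = Tgt K (m (t - 1)) \<longrightarrow>
        arr_orbit G A ma = arr_orbit G A mb \<longrightarrow>
        (\<exists>g\<in>carrier G. Farr (A g) ma = mb \<and> (\<forall>i\<in>{1..t-1}. Farr (A g) (m i) = m i)))"

text \<open>A cocone under the diagram \<open>A\<close> with vertex \<open>L\<close> is a functor \<open>F\<close> from \<open>K\<close> to \<open>L\<close> with
  \<open>F \<circ> A g = F\<close> for all \<open>g\<close>; the quotient \<open>K/G\<close> is the colimit of \<open>A\<close>, i.e. the universal
  such cocone. The category \<open>Cat\<close> in which the colimit is taken consists of all small
  categories with objects of type \<open>'o\<close> and morphisms of type \<open>'m\<close>, the types over which \<open>K\<close>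
  itself lives: a HOL formula cannot quantify over types, so these play the role of the universe
  of small sets. They are arbitrary, and \<open>Q\<close> ranges over the same \<open>Cat\<close>.\<close>

definition invariant_cocone ::
    "('g, 'b) monoid_scheme \<Rightarrow> ('o, 'm) cat \<Rightarrow> ('g \<Rightarrow> ('o, 'm, 'o, 'm) cfunctor) \<Rightarrow>
     ('p, 'n) cat \<Rightarrow> ('o, 'm, 'p, 'n) cfunctor \<Rightarrow> bool" where
  "invariant_cocone G K A L F \<longleftrightarrow>
     is_category L \<and> is_functor K L F \<and>
     (\<forall>g\<in>carrier G. functor_eq K (comp_functor F (A g)) F)"

definition is_quotient ::
    "('g, 'b) monoid_scheme \<Rightarrow> ('o, 'm) cat \<Rightarrow> ('g \<Rightarrow> ('o, 'm, 'o, 'm) cfunctor) \<Rightarrow>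
     ('o, 'm) cat \<Rightarrow> ('o, 'm, 'o, 'm) cfunctor \<Rightarrow> bool" where
  "is_quotient G K A Q P \<longleftrightarrow>
     invariant_cocone G K A Q P \<and>
     (\<forall>(L :: ('o, 'm) cat) F. invariant_cocone G K A L F \<longrightarrow>
        (\<exists>H. is_functor Q L H \<and> functor_eq K (comp_functor H P) F \<and>
           (\<forall>H'. is_functor Q L H' \<and> functor_eq K (comp_functor H' P) F \<longrightarrow>
              functor_eq Q H' H)))"

section \<open>The nerve and the Moebius function\<close>

text \<open>An \<open>n\<close>-simplex of the nerve is a functor from \<open>{0 < ... < n}\<close> to \<open>K\<close>, i.e. a chain of
  \<open>n\<close> composable morphisms. It is represented by its initial vertex together with the list
  of these morphisms, so that objects are exactly the \<open>0\<close>-simplices \<open>(x, [])\<close>.\<close>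

fun composable_from :: "('o, 'm) cat \<Rightarrow> 'o \<Rightarrow> 'm list \<Rightarrow> bool" where
  "composable_from K x [] \<longleftrightarrow> x \<in> Obj K"
| "composable_from K x (m # ms) \<longleftrightarrow>
     x \<in> Obj K \<and> m \<in> Arr K \<and> Src K m = x \<and> composable_from K (Tgt K m) ms"

definition nerve :: "('o, 'm) cat \<Rightarrow> nat \<Rightarrow> ('o \<times> 'm list) set" where
  "nerve K n = {(x, ms). composable_from K x ms \<and> length ms = n}"

definition vertex :: "('o, 'm) cat \<Rightarrow> nat \<Rightarrow> 'o \<times> 'm list \<Rightarrow> 'o" where
  "vertex K i \<sigma> = (if i = 0 then fst \<sigma> else Tgt K (snd \<sigma> ! (i - 1)))"

definition degeneracy :: "('o, 'm) cat \<Rightarrow> nat \<Rightarrow> 'o \<times> 'm list \<Rightarrow> 'o \<times> 'm list" where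
  "degeneracy K i \<sigma> = (fst \<sigma>, take i (snd \<sigma>) @ Idt K (vertex K i \<sigma>) # drop i (snd \<sigma>))"

definition nondegenerate :: "('o, 'm) cat \<Rightarrow> nat \<Rightarrow> ('o \<times> 'm list) set" where
  "nondegenerate K n =
     {\<sigma> \<in> nerve K n. \<not> (\<exists>k i \<tau>. n = Suc k \<and> i \<le> k \<and> \<tau> \<in> nerve K k \<and> \<sigma> = degeneracy K i \<tau>)}"

definition finite_nerve :: "('o, 'm) cat \<Rightarrow> bool" where
  "finite_nerve K \<longleftrightarrow> finite (\<Union>n. nondegenerate K n)"

text \<open>Only meaningful if \<open>finite_nerve K\<close>; the dimension of a simplex \<open>(x, ms)\<close> is \<open>length ms\<close>.\<close>

definition euler_char :: "('o, 'm) cat \<Rightarrow> int" where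
  "euler_char K = (\<Sum>\<sigma>\<in>(\<Union>n. nondegenerate K n). (- 1) ^ length (snd \<sigma>))"

definition moebius :: "('o, 'm) cat \<Rightarrow> int" where
  "moebius K = euler_char K - 1"

end

theory Submission
  imports Defs
begin

text \<open>The nondegenerate simplices of the nerve are the chains of composable morphisms without
  identities, for \<open>K\<close> as for its quotient \<open>Q\<close> and the fixed subcategories \<open>K\<^sub>g\<close>
  (\<open>nondegenerate_eq\<close>). In the finite loopfree category \<open>K\<close> there are only finitely many
  (\<open>finite_proper_chains\<close>), and \<open>G\<close> permutes them preserving dimension. The chains of
  \<open>K\<^sub>g\<close> are those fixed by \<open>g\<close>, and under Condition (C) the chains of \<open>Q\<close> are the
  \<open>G\<close>-orbits of chains of \<open>K\<close>. Burnside's lemma, with the weight \<open>(-1)\<close> to the dimension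
  (\<open>weighted_burnside\<close>), therefore gives the formula for the Euler characteristics; passing to the
  reduced ones subtracts \<open>1\<close> from each term of the average and from the left-hand side.

  The identification of the chains of \<open>Q\<close> uses Condition (C) twice. For \<open>t = 2\<close> it makes
  composition of orbits of morphisms well defined, so that orbits of objects and of morphisms form a
  category (\<open>category_orbit_category\<close>). Comparing it with \<open>Q\<close> through the universal property
  shows that \<open>P\<close> is surjective on objects and on morphisms and that its fibres are exactly the
  orbits (\<open>quotient_surj\<close>, \<open>quotient_obj_eq_iff\<close>, \<open>quotient_arr_eq_iff\<close>). Hence
  chains lift along \<open>P\<close>, and for general \<open>t\<close> Condition (C) shows that two lifts of the same
  chain differ by a group element (\<open>chain_same_image_orbit\<close>).\<close>

section \<open>Weighted orbit counting\<close>

text \<open>An action on a carrier set \<open>X\<close>; outside \<open>X\<close> nothing is required of \<open>\<alpha>\<close>.\<close>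

locale set_action = group G for G :: "('g, 'b) monoid_scheme" (structure) +
  fixes X :: "'x set" and \<alpha> :: "'g \<Rightarrow> 'x \<Rightarrow> 'x"
  assumes closed: "g \<in> carrier G \<Longrightarrow> x \<in> X \<Longrightarrow> \<alpha> g x \<in> X"
    and act_one: "x \<in> X \<Longrightarrow> \<alpha> \<one> x = x"
    and act_mult: "g \<in> carrier G \<Longrightarrow> h \<in> carrier G \<Longrightarrow> x \<in> X \<Longrightarrow> \<alpha> (g \<otimes> h) x = \<alpha> g (\<alpha> h x)"
begin

text \<open>The \<open>G\<close>-orbit of \<open>x\<close>.\<close>

definition orbit :: "'x \<Rightarrow> 'x set" where
  "orbit x = (\<lambda>g. \<alpha> g x) ` carrier G"

text \<open>A representative of the orbit of \<open>x\<close>, chosen from the orbit as a set, so that it is the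
  same for all points of one orbit.\<close>

definition rep :: "'x \<Rightarrow> 'x" where
  "rep x = (SOME y. y \<in> orbit x)"

lemma act_inv:
  assumes "g \<in> carrier G" "x \<in> X"
  shows "\<alpha> (inv g) (\<alpha> g x) = x" "\<alpha> g (\<alpha> (inv g) x) = x"
  using assms act_mult[of "inv g" g x] act_mult[of g "inv g" x] act_one by auto

lemma orbit_refl: "x \<in> X \<Longrightarrow> x \<in> orbit x"
  unfolding orbit_def by (rule image_eqI[where x = \<one>]) (simp_all add: act_one)

lemma orbit_act:
  assumes g: "g \<in> carrier G" and x: "x \<in> X"
  shows "orbit (\<alpha> g x) = orbit x"
proof
  show "orbit (\<alpha> g x) \<subseteq> orbit x"
    using g x by (auto simp: orbit_def act_mult[symmetric])
  show "orbit x \<subseteq> orbit (\<alpha> g x)"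
  proof
    fix y assume "y \<in> orbit x"
    then obtain h where h: "h \<in> carrier G" "y = \<alpha> h x" by (auto simp: orbit_def)
    then have "y = \<alpha> (h \<otimes> inv g) (\<alpha> g x)"
      using g x closed by (simp add: act_mult act_inv)
    then show "y \<in> orbit (\<alpha> g x)" using h g by (auto simp: orbit_def)
  qed
qed

lemma orbit_eq_iff:
  assumes "x \<in> X" "y \<in> X"
  shows "orbit x = orbit y \<longleftrightarrow> (\<exists>g\<in>carrier G. \<alpha> g x = y)"
proof
  assume "orbit x = orbit y"
  then have "y \<in> orbit x" using orbit_refl assms by simp
  then show "\<exists>g\<in>carrier G. \<alpha> g x = y" by (auto simp: orbit_def)
qed (use orbit_act assms in auto)

lemma rep_in_orbit: "x \<in> X \<Longrightarrow> rep x \<in> orbit x"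
  unfolding rep_def by (rule someI) (rule orbit_refl)

lemma rep_act: "x \<in> X \<Longrightarrow> \<exists>g\<in>carrier G. rep x = \<alpha> g x"
  using rep_in_orbit by (auto simp: orbit_def)

lemma rep_closed: "x \<in> X \<Longrightarrow> rep x \<in> X"
  by (metis rep_act closed)

lemma orbit_rep: "x \<in> X \<Longrightarrow> orbit (rep x) = orbit x"
  by (metis rep_act orbit_act)

lemma rep_eq_iff:
  assumes "x \<in> X" "y \<in> X"
  shows "rep x = rep y \<longleftrightarrow> orbit x = orbit y"
  using orbit_rep assms by (metis rep_def)

lemma rep_rep: "x \<in> X \<Longrightarrow> rep (rep x) = rep x"
  using orbit_rep by (simp add: rep_def)

lemma rep_invariant: "g \<in> carrier G \<Longrightarrow> x \<in> X \<Longrightarrow> rep (\<alpha> g x) = rep x"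
  by (simp add: rep_def orbit_act)

text \<open>Burnside's lemma with an invariant weight \<open>w\<close>. The orbits are given as the fibres of a map
  \<open>\<phi>\<close>, so that the orbit set may be any set in bijection with \<open>X/G\<close>.\<close>

lemma weighted_burnside:
  fixes w :: "'q \<Rightarrow> 'r::comm_semiring_1"
  assumes finG: "finite (carrier G)" and finX: "finite X"
    and fibre: "\<And>x y. x \<in> X \<Longrightarrow> y \<in> X \<Longrightarrow> \<phi> x = \<phi> y \<longleftrightarrow> (\<exists>g\<in>carrier G. \<alpha> g x = y)"
  shows "of_nat (card (carrier G)) * (\<Sum>q\<in>\<phi> ` X. w q)
    = (\<Sum>g\<in>carrier G. \<Sum>x\<in>{x\<in>X. \<alpha> g x = x}. w (\<phi> x))"
proof -
  let ?stab = "\<lambda>x. {g\<in>carrier G. \<alpha> g x = x}"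
  have count: "card (carrier G) = (\<Sum>y\<in>{y\<in>X. \<phi> y = \<phi> x}. card (?stab y))" if x: "x \<in> X" for x
  proof -
    let ?T = "\<lambda>y. {g\<in>carrier G. \<alpha> g x = y}"
    let ?F = "{y\<in>X. \<phi> y = \<phi> x}"
    have "carrier G = (\<Union>y\<in>?F. ?T y)"
      using fibre[OF x] closed[OF _ x] by (auto simp: eq_commute[of _ "\<phi> x"])
    then have "card (carrier G) = card (\<Union>y\<in>?F. ?T y)" by simp
    also have "\<dots> = (\<Sum>y\<in>?F. card (?T y))"
      by (rule card_UN_disjoint) (use finX finG in auto)
    also have "\<dots> = (\<Sum>y\<in>?F. card (?stab y))"
    proof (rule sum.cong[OF refl])
      fix y assume "y \<in> ?F"
      then have y: "y \<in> X" "\<phi> x = \<phi> y" by auto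
      then obtain h where h: "h \<in> carrier G" "\<alpha> h x = y" using fibre[OF x] by auto
      \<comment> \<open>the elements moving \<open>x\<close> to \<open>y\<close> form a coset of the stabilizer of \<open>y\<close>\<close>
      have "bij_betw (\<lambda>g. g \<otimes> h) (?stab y) (?T y)"
        by (rule bij_betwI[where g = "\<lambda>g. g \<otimes> inv h"])
          (use h x act_inv(1)[OF h(1) x] in \<open>auto simp: act_mult closed m_assoc\<close>)
      then show "card (?T y) = card (?stab y)" by (simp add: bij_betw_same_card)
    qed
    finally show ?thesis .
  qed
  have "of_nat (card (carrier G)) * (\<Sum>q\<in>\<phi> ` X. w q)
      = (\<Sum>q\<in>\<phi> ` X. \<Sum>y\<in>{y\<in>X. \<phi> y = q}. of_nat (card (?stab y)) * w (\<phi> y))"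
    unfolding sum_distrib_left
  proof (rule sum.cong[OF refl])
    fix q assume "q \<in> \<phi> ` X"
    then obtain x where x: "x \<in> X" "q = \<phi> x" by auto
    have "of_nat (card (carrier G)) * w q = (\<Sum>y\<in>{y\<in>X. \<phi> y = q}. of_nat (card (?stab y))) * w q"
      using count[OF x(1)] x(2) by simp
    also have "\<dots> = (\<Sum>y\<in>{y\<in>X. \<phi> y = q}. of_nat (card (?stab y)) * w (\<phi> y))"
      by (simp add: sum_distrib_right)
    finally show "of_nat (card (carrier G)) * w q = \<dots>" .
  qed
  also have "\<dots> = (\<Sum>y\<in>X. of_nat (card (?stab y)) * w (\<phi> y))"
    by (rule sum.group) (use finX in auto)
  also have "\<dots> = (\<Sum>y\<in>X. \<Sum>g\<in>carrier G. if \<alpha> g y = y then w (\<phi> y) else 0)"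
    using finG by (simp add: sum.If_cases Int_def)
  also have "\<dots> = (\<Sum>g\<in>carrier G. \<Sum>y\<in>X. if \<alpha> g y = y then w (\<phi> y) else 0)"
    by (rule sum.swap)
  also have "\<dots> = (\<Sum>g\<in>carrier G. \<Sum>x\<in>{x\<in>X. \<alpha> g x = x}. w (\<phi> x))"
    using finX by (simp add: sum.If_cases Int_def)
  finally show ?thesis .
qed

end

section \<open>Nondegenerate simplices\<close>

lemma category_arrD:
  assumes "is_category K" "m \<in> Arr K"
  shows "Src K m \<in> Obj K" "Tgt K m \<in> Obj K"
    "Cmp K m (Idt K (Src K m)) = m" "Cmp K (Idt K (Tgt K m)) m = m"
  using assms by (simp_all add: is_category_def)

lemma category_idtD:
  assumes "is_category K" "x \<in> Obj K"
  shows "Idt K x \<in> Arr K" "Src K (Idt K x) = x" "Tgt K (Idt K x) = x"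
  using assms by (simp_all add: is_category_def)

lemma category_cmpD:
  assumes "is_category K" "m \<in> Arr K" "n \<in> Arr K" "Src K n = Tgt K m"
  shows "Cmp K n m \<in> Arr K" "Src K (Cmp K n m) = Src K m" "Tgt K (Cmp K n m) = Tgt K n"
  using assms by (simp_all add: is_category_def)

lemma category_assoc:
  assumes "is_category K" "l \<in> Arr K" "m \<in> Arr K" "n \<in> Arr K"
    "Src K m = Tgt K l" "Src K n = Tgt K m"
  shows "Cmp K n (Cmp K m l) = Cmp K (Cmp K n m) l"
  using assms by (simp add: is_category_def)

lemma functorD:
  assumes "is_functor K L F"
  shows "x \<in> Obj K \<Longrightarrow> Fobj F x \<in> Obj L"
    "m \<in> Arr K \<Longrightarrow> Farr F m \<in> Arr L"
    "m \<in> Arr K \<Longrightarrow> Src L (Farr F m) = Fobj F (Src K m)"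
    "m \<in> Arr K \<Longrightarrow> Tgt L (Farr F m) = Fobj F (Tgt K m)"
    "x \<in> Obj K \<Longrightarrow> Farr F (Idt K x) = Idt L (Fobj F x)"
    "m \<in> Arr K \<Longrightarrow> n \<in> Arr K \<Longrightarrow> Src K n = Tgt K m \<Longrightarrow>
       Farr F (Cmp K n m) = Cmp L (Farr F n) (Farr F m)"
  using assms by (simp_all add: is_functor_def)

lemma functor_eqD:
  assumes "functor_eq K F H"
  shows "x \<in> Obj K \<Longrightarrow> Fobj F x = Fobj H x" "m \<in> Arr K \<Longrightarrow> Farr F m = Farr H m"
  using assms by (simp_all add: functor_eq_def)

lemma vertex_Cons: "vertex K (Suc i) (x, m # ms) = vertex K i (Tgt K m, ms)"
  by (cases i) (simp_all add: vertex_def)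

lemma vertex_append: "i \<le> length us \<Longrightarrow> vertex K i (x, us @ vs) = vertex K i (x, us)"
  by (cases i) (simp_all add: vertex_def nth_append)

lemma composable_from_obj: "composable_from K x ms \<Longrightarrow> x \<in> Obj K"
  by (cases ms) auto

lemma composable_from_append:
  "composable_from K x (us @ vs) \<longleftrightarrow>
     composable_from K x us \<and> composable_from K (vertex K (length us) (x, us)) vs"
proof (induction us arbitrary: x)
  case Nil
  then show ?case using composable_from_obj by (auto simp: vertex_def)
next
  case (Cons m us)
  then show ?case by (auto simp: vertex_Cons)
qed

lemma composable_from_arr: "composable_from K x ms \<Longrightarrow> m \<in> set ms \<Longrightarrow> m \<in> Arr K"
  by (induction ms arbitrary: x) auto

lemma composable_from_nth:
  assumes "composable_from K x ms" "i < length ms"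
  shows "Src K (ms ! i) = vertex K i (x, ms)"
proof -
  have "composable_from K x (take i ms @ ms ! i # drop (Suc i) ms)"
    using assms by (simp add: id_take_nth_drop[symmetric])
  then have "Src K (ms ! i) = vertex K i (x, take i ms)"
    using assms(2) by (simp only: composable_from_append) (simp add: min_absorb2)
  also have "\<dots> = vertex K i (x, take i ms @ drop i ms)"
    using assms(2) by (subst vertex_append) auto
  finally show ?thesis by simp
qed

lemma composable_from_vertex:
  assumes "composable_from K x ms" "i \<le> length ms"
  shows "vertex K i (x, ms) \<in> Obj K"
proof -
  have "composable_from K x (take i ms @ drop i ms)" using assms by simp
  then have "composable_from K (vertex K i (x, take i ms)) (drop i ms)"
    using assms(2) by (simp only: composable_from_append) (simp add: min_absorb2)
  then have "vertex K i (x, take i ms) \<in> Obj K" by (rule composable_from_obj)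
  then show ?thesis
    using assms(2) vertex_append[of i "take i ms" K x "drop i ms"] by simp
qed

lemma composable_from_functor:
  "is_functor K L F \<Longrightarrow> composable_from K x ms \<Longrightarrow>
     composable_from L (Fobj F x) (map (Farr F) ms)"
proof (induction ms arbitrary: x)
  case (Cons m ms)
  then have "composable_from L (Fobj F (Tgt K m)) (map (Farr F) ms)" by simp
  with Cons.prems show ?case by (simp add: functorD)
qed (simp add: functorD)

text \<open>The chains of composable morphisms none of which is an identity, of any length.\<close>

definition proper_chains :: "('o, 'm) cat \<Rightarrow> ('o \<times> 'm list) set" where
  "proper_chains K = {(x, ms). composable_from K x ms \<and> set ms \<inter> Idt K ` Obj K = {}}"

lemma nondegenerate_eq:
  assumes K: "is_category K"
  shows "nondegenerate K n = {\<sigma> \<in> proper_chains K. length (snd \<sigma>) = n}"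
proof (intro equalityI subsetI)
  fix \<sigma> assume \<sigma>: "\<sigma> \<in> nondegenerate K n"
  obtain x ms where [simp]: "\<sigma> = (x, ms)" by (cases \<sigma>)
  have c: "composable_from K x ms" "length ms = n"
    using \<sigma> by (auto simp: nondegenerate_def nerve_def)
  have False if y: "y \<in> Obj K" "Idt K y \<in> set ms" for y
  proof -
    obtain us vs where ms: "ms = us @ Idt K y # vs" using y by (auto simp: in_set_conv_decomp)
    let ?\<tau> = "(x, us @ vs)"
    have u: "composable_from K x us" "vertex K (length us) (x, us) = y" "composable_from K y vs"
      using c(1) y category_idtD[OF K y(1)] by (auto simp: ms composable_from_append)
    then have "?\<tau> \<in> nerve K (length (us @ vs))"
      by (simp add: nerve_def composable_from_append)
    moreover have "\<sigma> = degeneracy K (length us) ?\<tau>"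
      using u(2) by (simp add: ms degeneracy_def vertex_append)
    moreover have "n = Suc (length (us @ vs))" using c(2) by (simp add: ms)
    moreover have "length us \<le> length (us @ vs)" by simp
    ultimately show False using \<sigma> unfolding nondegenerate_def by blast
  qed
  then show "\<sigma> \<in> {\<sigma> \<in> proper_chains K. length (snd \<sigma>) = n}"
    using c by (auto simp: proper_chains_def)
next
  fix \<sigma> assume "\<sigma> \<in> {\<sigma> \<in> proper_chains K. length (snd \<sigma>) = n}"
  then obtain x ms where \<sigma>: "\<sigma> = (x, ms)" "composable_from K x ms" "length ms = n"
    "set ms \<inter> Idt K ` Obj K = {}" by (cases \<sigma>) (auto simp: proper_chains_def)
  have False if "i \<le> k" "\<tau> \<in> nerve K k" "\<sigma> = degeneracy K i \<tau>" for k i \<tau>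
  proof -
    have "vertex K i \<tau> \<in> Obj K"
      using that composable_from_vertex[of K "fst \<tau>" "snd \<tau>" i] by (auto simp: nerve_def)
    moreover have "Idt K (vertex K i \<tau>) \<in> set ms"
      using that(3) \<sigma>(1) by (simp add: degeneracy_def)
    ultimately show False using \<sigma>(4) by auto
  qed
  then show "\<sigma> \<in> nondegenerate K n"
    using \<sigma> by (auto simp: nondegenerate_def nerve_def)
qed

lemma Union_nondegenerate: "is_category K \<Longrightarrow> (\<Union>n. nondegenerate K n) = proper_chains K"
  by (auto simp: nondegenerate_eq)

lemma composable_from_reach:
  assumes K: "is_category K"
  shows "composable_from K x ms \<Longrightarrow> m \<in> set ms \<Longrightarrow> homset K x (Src K m) \<noteq> {}"
proof (induction ms arbitrary: x)
  case (Cons a ms)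
  show ?case
  proof (cases "m = a")
    case True
    then show ?thesis using Cons.prems category_idtD[OF K, of x] by (auto simp: homset_def)
  next
    case False
    then obtain b where "b \<in> homset K (Tgt K a) (Src K m)" using Cons by auto
    then have "Cmp K b a \<in> homset K x (Src K m)"
      using Cons.prems category_cmpD[OF K, of a b] by (auto simp: homset_def)
    then show ?thesis by auto
  qed
qed simp

text \<open>In a loopfree category a proper chain cannot repeat a morphism, which bounds its length.\<close>

lemma finite_proper_chains:
  assumes fin: "finite_category K" and loop: "loopfree K"
  shows "finite (proper_chains K)"
proof -
  have K: "is_category K" using fin by (simp add: finite_category_def)
  have "distinct ms" if "composable_from K x ms" "set ms \<inter> Idt K ` Obj K = {}" for x ms
    using that
  proof (induction ms arbitrary: x)
    case (Cons a ms)
    have "a \<notin> set ms"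
    proof
      assume "a \<in> set ms"
      then have "homset K (Tgt K a) (Src K a) \<noteq> {}"
        using composable_from_reach[OF K] Cons.prems by auto
      moreover have a: "a \<in> homset K (Src K a) (Tgt K a)"
        using Cons.prems by (simp add: homset_def)
      moreover have o: "Src K a \<in> Obj K" "Tgt K a \<in> Obj K"
        using Cons.prems category_arrD[OF K] by auto
      ultimately have "Src K a = Tgt K a" using loop unfolding loopfree_def by blast
      then have "a = Idt K (Src K a)" using loop o a unfolding loopfree_def by auto
      with o show False using Cons.prems(2) by auto
    qed
    with Cons show ?case by auto
  qed simp
  then have "proper_chains K \<subseteq> Obj K \<times> {ms. set ms \<subseteq> Arr K \<and> distinct ms}"
    using composable_from_arr composable_from_obj by (fastforce simp: proper_chains_def)
  moreover have "finite (Obj K \<times> {ms. set ms \<subseteq> Arr K \<and> distinct ms})"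
    using fin by (simp add: finite_category_def finite_subset_distinct)
  ultimately show ?thesis by (rule finite_subset)
qed

text \<open>The map induced by a functor on simplices of the nerve.\<close>

definition simplex_map ::
    "('o, 'm, 'p, 'n) cfunctor \<Rightarrow> 'o \<times> 'm list \<Rightarrow> 'p \<times> 'n list" where
  "simplex_map F \<sigma> = (Fobj F (fst \<sigma>), map (Farr F) (snd \<sigma>))"

section \<open>The orbit category\<close>

text \<open>A group acting on a category; it then acts on objects, on morphisms and on nondegenerate
  simplices.\<close>

locale acted_category = group G for G :: "('g, 'b) monoid_scheme" (structure) +
  fixes K :: "('o, 'm) cat" and A :: "'g \<Rightarrow> ('o, 'm, 'o, 'm) cfunctor"
  assumes category: "is_category K"
    and action: "category_action G K A"
begin

lemma action_functor: "g \<in> carrier G \<Longrightarrow> is_functor K K (A g)"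
  using action by (simp add: category_action_def)

lemmas actD = functorD[OF action_functor]

lemma action_one: "functor_eq K (A \<one>) id_functor"
  using action by (simp add: category_action_def)

lemma action_mult:
  "g \<in> carrier G \<Longrightarrow> h \<in> carrier G \<Longrightarrow> functor_eq K (A (g \<otimes> h)) (comp_functor (A g) (A h))"
  using action by (simp add: category_action_def)

sublocale obj: set_action G "Obj K" "\<lambda>g. Fobj (A g)"
  using functor_eqD(1)[OF action_one] functor_eqD(1)[OF action_mult]
  by unfold_locales (auto simp: actD id_functor_def comp_functor_def)

sublocale arr: set_action G "Arr K" "\<lambda>g. Farr (A g)"
  using functor_eqD(2)[OF action_one] functor_eqD(2)[OF action_mult]
  by unfold_locales (auto simp: actD id_functor_def comp_functor_def)

lemma arr_orbit_eq: "arr_orbit G A m = arr.orbit m"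
  by (simp add: arr_orbit_def arr.orbit_def)

lemma identity_act_iff:
  assumes g: "g \<in> carrier G" and m: "m \<in> Arr K"
  shows "Farr (A g) m \<in> Idt K ` Obj K \<longleftrightarrow> m \<in> Idt K ` Obj K"
proof
  assume "Farr (A g) m \<in> Idt K ` Obj K"
  then obtain y where y: "y \<in> Obj K" "Farr (A g) m = Idt K y" by auto
  have "m = Farr (A (inv g)) (Farr (A g) m)" using arr.act_inv g m by simp
  also have "\<dots> = Idt K (Fobj (A (inv g)) y)" using y g by (simp add: actD)
  finally show "m \<in> Idt K ` Obj K" using y g by (auto simp: actD)
qed (use g in \<open>auto simp: actD\<close>)

sublocale chains: set_action G "proper_chains K" "\<lambda>g. simplex_map (A g)"
proof unfold_locales
  fix g \<sigma> assume g: "g \<in> carrier G" and \<sigma>: "\<sigma> \<in> proper_chains K"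
  then have "m \<in> Arr K" if "m \<in> set (snd \<sigma>)" for m
    using that by (auto simp: proper_chains_def intro: composable_from_arr)
  then show "simplex_map (A g) \<sigma> \<in> proper_chains K"
    using \<sigma> composable_from_functor[OF action_functor[OF g], of "fst \<sigma>" "snd \<sigma>"]
      identity_act_iff[OF g]
    by (fastforce simp: proper_chains_def simplex_map_def)
next
  fix \<sigma> assume \<sigma>: "\<sigma> \<in> proper_chains K"
  then show "simplex_map (A \<one>) \<sigma> = \<sigma>"
    using composable_from_arr[of K "fst \<sigma>" "snd \<sigma>"] composable_from_obj[of K "fst \<sigma>" "snd \<sigma>"]
    by (auto simp: proper_chains_def simplex_map_def obj.act_one arr.act_one intro!: map_idI)
next
  fix g h \<sigma> assume "g \<in> carrier G" "h \<in> carrier G" and \<sigma>: "\<sigma> \<in> proper_chains K"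
  then show "simplex_map (A (g \<otimes> h)) \<sigma> = simplex_map (A g) (simplex_map (A h) \<sigma>)"
    using composable_from_arr[of K "fst \<sigma>" "snd \<sigma>"] composable_from_obj[of K "fst \<sigma>" "snd \<sigma>"]
    by (auto simp: proper_chains_def simplex_map_def obj.act_mult arr.act_mult)
qed

lemma category_fixed:
  assumes "g \<in> carrier G"
  shows "is_category (fixed_subcategory K (A g))"
proof -
  have "Fobj (A g) (Src K m) = Src K m" "Fobj (A g) (Tgt K m) = Tgt K m"
    if "m \<in> Arr K" "Farr (A g) m = m" for m
    using actD(3,4)[OF assms that(1)] that(2) by simp_all
  then show ?thesis
    using category actD[OF assms] unfolding is_category_def
    by (simp add: fixed_subcategory_def)
qed

lemma proper_chains_fixed:
  assumes g: "g \<in> carrier G"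
  shows "proper_chains (fixed_subcategory K (A g))
    = {\<sigma> \<in> proper_chains K. simplex_map (A g) \<sigma> = \<sigma>}"
proof -
  let ?L = "fixed_subcategory K (A g)"
  have comp: "composable_from ?L x ms \<longleftrightarrow>
      composable_from K x ms \<and> Fobj (A g) x = x \<and> map (Farr (A g)) ms = ms" for x ms
  proof (induction ms arbitrary: x)
    case (Cons m ms)
    \<comment> \<open>a fixed morphism has a fixed target\<close>
    have "Fobj (A g) (Tgt K m) = Tgt K m" if "m \<in> Arr K" "Farr (A g) m = m"
      using actD(4)[OF g that(1)] that(2) by simp
    with Cons.IH[of "Tgt K m"] show ?case by (auto simp: fixed_subcategory_def)
  qed (auto simp: fixed_subcategory_def)
  have idt: "Idt K x \<in> Idt ?L ` Obj ?L"
    if "x \<in> Obj K" "Farr (A g) (Idt K x) = Idt K x" for x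
  proof -
    have "Fobj (A g) x = x"
      using actD(3)[OF g, of "Idt K x"] that category_idtD[OF category that(1)] by simp
    with that show ?thesis by (auto simp: fixed_subcategory_def)
  qed
  have sub: "Idt ?L ` Obj ?L \<subseteq> Idt K ` Obj K" by (auto simp: fixed_subcategory_def)
  have proper: "set ms \<inter> Idt ?L ` Obj ?L = {} \<longleftrightarrow> set ms \<inter> Idt K ` Obj K = {}"
    if "map (Farr (A g)) ms = ms" for ms
  proof -
    have "Farr (A g) m = m" if "m \<in> set ms" for m
      using \<open>map (Farr (A g)) ms = ms\<close> that by (metis map_eq_conv map_ident)
    with idt sub show ?thesis by blast
  qed
  have "(x, ms) \<in> proper_chains ?L \<longleftrightarrow>
      (x, ms) \<in> proper_chains K \<and> simplex_map (A g) (x, ms) = (x, ms)" for x ms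
    by (cases "map (Farr (A g)) ms = ms")
      (auto simp only: proper_chains_def simplex_map_def comp proper mem_Collect_eq case_prod_conv
        fst_conv snd_conv prod.inject)
  then show ?thesis by auto
qed

text \<open>The orbit category, with every orbit encoded by its chosen representative; thus its objects
  and morphisms have the same types as those of \<open>K\<close>. To compose the orbits of \<open>m\<close> and \<open>n\<close>, move
  \<open>n\<close> within its orbit until it starts where \<open>m\<close> ends.\<close>

definition orbit_category :: "('o, 'm) cat" where
  "orbit_category =
     \<lparr>Obj = obj.rep ` Obj K, Arr = arr.rep ` Arr K,
      Src = (\<lambda>m. obj.rep (Src K m)), Tgt = (\<lambda>m. obj.rep (Tgt K m)),
      Idt = (\<lambda>x. arr.rep (Idt K x)),
      Cmp = (\<lambda>n m. arr.rep (Cmp K (SOME n'. n' \<in> arr.orbit n \<and> Src K n' = Tgt K m) m))\<rparr>"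

text \<open>The projection of \<open>K\<close> onto its orbit category.\<close>

definition orbit_functor :: "('o, 'm, 'o, 'm) cfunctor" where
  "orbit_functor = \<lparr>Fobj = obj.rep, Farr = arr.rep\<rparr>"

lemma arr_orbit_mem: "m \<in> Arr K \<Longrightarrow> n \<in> arr.orbit m \<Longrightarrow> n \<in> Arr K \<and> arr.orbit n = arr.orbit m"
  using arr.closed arr.orbit_act by (auto simp: arr.orbit_def[of m])

lemma rep_src: "m \<in> Arr K \<Longrightarrow> n \<in> arr.orbit m \<Longrightarrow> obj.rep (Src K n) = obj.rep (Src K m)"
  using obj.rep_invariant category_arrD[OF category] by (auto simp: arr.orbit_def actD)

lemma rep_tgt: "m \<in> Arr K \<Longrightarrow> n \<in> arr.orbit m \<Longrightarrow> obj.rep (Tgt K n) = obj.rep (Tgt K m)"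
  using obj.rep_invariant category_arrD[OF category] by (auto simp: arr.orbit_def actD)

lemma rep_idt:
  assumes x: "x \<in> Obj K"
  shows "arr.rep (Idt K (obj.rep x)) = arr.rep (Idt K x)"
proof -
  obtain g where g: "g \<in> carrier G" "obj.rep x = Fobj (A g) x" using obj.rep_act[OF x] by auto
  then have "arr.rep (Idt K (obj.rep x)) = arr.rep (Farr (A g) (Idt K x))"
    using actD(5)[OF g(1) x] by simp
  also have "\<dots> = arr.rep (Idt K x)"
    by (rule arr.rep_invariant[OF g(1) category_idtD(1)[OF category x]])
  finally show ?thesis .
qed

lemma move_source:
  assumes n: "n \<in> Arr K" and x: "x \<in> Obj K" "obj.rep (Src K n) = obj.rep x"
  shows "\<exists>n'\<in>arr.orbit n. Src K n' = x"
proof -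
  obtain g where "g \<in> carrier G" "Fobj (A g) (Src K n) = x"
    using x category_arrD(1)[OF category n] by (auto simp: obj.rep_eq_iff obj.orbit_eq_iff)
  then show ?thesis using n by (auto simp: arr.orbit_def actD intro!: bexI[of _ g])
qed

end

locale condition_C_category = acted_category +
  assumes cond: "condition_C G K A"
begin

text \<open>Condition (C) for a chain given as a list.\<close>

lemma condition_C_list:
  assumes c: "composable_from K x ms" and "ms \<noteq> []"
    and a: "a \<in> Arr K" "Src K a = vertex K (length ms) (x, ms)"
    and b: "b \<in> Arr K" "Src K b = vertex K (length ms) (x, ms)"
    and orb: "arr.orbit a = arr.orbit b"
  shows "\<exists>g\<in>carrier G. Farr (A g) a = b \<and> map (Farr (A g)) ms = ms"
proof -
  let ?t = "Suc (length ms)"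
  let ?m = "\<lambda>i. ms ! (i - 1)"
  have arrs: "\<forall>i\<in>{1..?t - 1}. ?m i \<in> Arr K"
    using composable_from_arr[OF c] by auto
  have chain: "\<forall>i\<in>{2..?t - 1}. Src K (?m i) = Tgt K (?m (i - 1))"
  proof
    fix i assume "i \<in> {2..?t - 1}"
    then show "Src K (?m i) = Tgt K (?m (i - 1))"
      using composable_from_nth[OF c, of "i - 1"] by (auto simp: vertex_def)
  qed
  have "Src K a = Tgt K (?m (?t - 1))" "Src K b = Tgt K (?m (?t - 1))" "?t \<ge> 2"
    using a b \<open>ms \<noteq> []\<close> by (auto simp: vertex_def Suc_le_eq)
  then obtain g where g: "g \<in> carrier G" "Farr (A g) a = b"
      "\<forall>i\<in>{1..?t - 1}. Farr (A g) (?m i) = ?m i"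
    using cond[unfolded condition_C_def arr_orbit_eq, rule_format, of ?t ?m a b]
      arrs chain a b orb by auto
  have "map (Farr (A g)) ms = ms"
  proof (rule nth_equalityI)
    fix i assume "i < length (map (Farr (A g)) ms)"
    then show "map (Farr (A g)) ms ! i = ms ! i" using g(3)[rule_format, of "Suc i"] by simp
  qed simp
  with g show ?thesis by auto
qed

text \<open>The composite of two orbits does not depend on the composable representatives chosen:
  this is Condition (C) for \<open>t = 2\<close>.\<close>

lemma orbit_category_Cmp:
  assumes m: "m \<in> Arr K" "m' \<in> arr.orbit m" and n: "n \<in> Arr K" "n' \<in> arr.orbit n"
    and mn: "Src K n = Tgt K m"
  shows "Cmp orbit_category n' m' = arr.rep (Cmp K n m)"
proof -
  obtain h where h: "h \<in> carrier G" "m' = Farr (A h) m" using m by (auto simp: arr.orbit_def)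
  have m': "m' \<in> Arr K" using arr_orbit_mem[OF m] by simp
  have n': "arr.orbit n' = arr.orbit n" using arr_orbit_mem[OF n] by simp
  \<comment> \<open>the representative that the definition of the composite selects\<close>
  define k where "k = (SOME k. k \<in> arr.orbit n' \<and> Src K k = Tgt K m')"
  have hn: "Farr (A h) n \<in> Arr K" "Src K (Farr (A h) n) = Tgt K m'"
    using h n m mn by (auto simp: actD)
  have "Farr (A h) n \<in> arr.orbit n' \<and> Src K (Farr (A h) n) = Tgt K m'"
    unfolding n' using hn h(1) by (simp add: arr.orbit_def)
  then have "k \<in> arr.orbit n' \<and> Src K k = Tgt K m'" unfolding k_def by (rule someI)
  then have k: "k \<in> Arr K" "arr.orbit k = arr.orbit n" "Src K k = Tgt K m'"
    using arr_orbit_mem[OF n(1)] n' by auto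
  have "\<exists>g\<in>carrier G. Farr (A g) k = Farr (A h) n \<and> map (Farr (A g)) [m'] = [m']"
  proof (rule condition_C_list)
    show "composable_from K (Src K m') [m']" using m' category_arrD[OF category] by simp
    show "arr.orbit k = arr.orbit (Farr (A h) n)" using k h n by (simp add: arr.orbit_act)
  qed (use k hn in \<open>auto simp: vertex_def\<close>)
  then obtain g where g: "g \<in> carrier G" "Farr (A g) k = Farr (A h) n" "Farr (A g) m' = m'" by auto
  have "Farr (A g) (Cmp K k m') = Cmp K (Farr (A h) n) m'"
    using g k m' by (simp add: actD(6))
  also have "\<dots> = Farr (A h) (Cmp K n m)" using h m n mn by (simp add: actD(6))
  finally have "arr.rep (Cmp K k m') = arr.rep (Cmp K n m)"
    using arr.rep_invariant[OF g(1), of "Cmp K k m'"] arr.rep_invariant[OF h(1), of "Cmp K n m"]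
      category_cmpD(1)[OF category m(1) n(1) mn] category_cmpD(1)[OF category m' k(1,3)] by simp
  then show ?thesis by (simp add: orbit_category_def k_def)
qed

lemma orbit_category_ArrE:
  assumes "m \<in> Arr orbit_category"
  obtains "m \<in> Arr K" "arr.rep m = m"
  using assms arr.rep_closed arr.rep_rep by (auto simp: orbit_category_def)

lemma orbit_category_ObjE:
  assumes "x \<in> Obj orbit_category"
  obtains "x \<in> Obj K" "obj.rep x = x"
  using assms obj.rep_closed obj.rep_rep by (auto simp: orbit_category_def)

lemma orbit_category_composable:
  assumes m: "m \<in> Arr K" and n: "n \<in> Arr orbit_category"
    and mn: "Src orbit_category n = Tgt orbit_category m"
  obtains n' where "n' \<in> Arr K" "n \<in> arr.orbit n'" "n' \<in> arr.orbit n" "Src K n' = Tgt K m"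
proof -
  have n': "n \<in> Arr K" using n by (rule orbit_category_ArrE)
  obtain k where k: "k \<in> arr.orbit n" "Src K k = Tgt K m"
    using move_source[OF n', of "Tgt K m"] category_arrD(2)[OF category m] mn
    by (auto simp: orbit_category_def)
  moreover have "n \<in> arr.orbit k" using arr_orbit_mem[OF n' k(1)] arr.orbit_refl[OF n'] by simp
  ultimately show thesis using that arr_orbit_mem[OF n' k(1)] by blast
qed

lemma category_orbit_category: "is_category orbit_category"
proof -
  let ?L = orbit_category
  have sel: "Src ?L m = obj.rep (Src K m)" "Tgt ?L m = obj.rep (Tgt K m)"
    "Idt ?L x = arr.rep (Idt K x)" for m x
    by (simp_all add: orbit_category_def)
  have Obj_rep: "obj.rep x \<in> Obj ?L" if "x \<in> Obj K" for x
    using that by (simp add: orbit_category_def)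
  have Arr_rep: "arr.rep m \<in> Arr ?L" if "m \<in> Arr K" for m
    using that by (simp add: orbit_category_def)
  have rep_sides: "obj.rep (Src K (arr.rep m)) = obj.rep (Src K m)"
    "obj.rep (Tgt K (arr.rep m)) = obj.rep (Tgt K m)" if "m \<in> Arr K" for m
    using that rep_src rep_tgt arr.rep_in_orbit by auto
  have sides: "Src ?L m \<in> Obj ?L \<and> Tgt ?L m \<in> Obj ?L" if "m \<in> Arr ?L" for m
    using that category_arrD[OF category] Obj_rep by (auto simp: sel elim!: orbit_category_ArrE)
  have idts: "Idt ?L x \<in> Arr ?L \<and> Src ?L (Idt ?L x) = x \<and> Tgt ?L (Idt ?L x) = x"
    if "x \<in> Obj ?L" for x
    using that category_idtD[OF category] Arr_rep rep_sides
    by (auto simp: sel elim!: orbit_category_ObjE)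
  have comps: "Cmp ?L n m \<in> Arr ?L \<and> Src ?L (Cmp ?L n m) = Src ?L m
      \<and> Tgt ?L (Cmp ?L n m) = Tgt ?L n"
    if L: "m \<in> Arr ?L" "n \<in> Arr ?L" "Src ?L n = Tgt ?L m" for m n
  proof -
    have m: "m \<in> Arr K" using L(1) by (rule orbit_category_ArrE)
    obtain n' where n': "n' \<in> Arr K" "n \<in> arr.orbit n'" "n' \<in> arr.orbit n" "Src K n' = Tgt K m"
      using orbit_category_composable[OF m L(2,3)] .
    have "Cmp ?L n m = arr.rep (Cmp K n' m)"
      using orbit_category_Cmp[OF m arr.orbit_refl[OF m] n'(1,2,4)] .
    then show ?thesis
      using category_cmpD[OF category m n'(1) n'(4)] rep_tgt[OF n'(1,2)] Arr_rep
      by (simp add: sel rep_sides)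
  qed
  have units: "Cmp ?L m (Idt ?L (Src ?L m)) = m \<and> Cmp ?L (Idt ?L (Tgt ?L m)) m = m"
    if L: "m \<in> Arr ?L" for m
  proof -
    have m: "m \<in> Arr K" "arr.rep m = m" using L by (auto elim: orbit_category_ArrE)
    have idt: "Idt ?L (obj.rep x) \<in> arr.orbit (Idt K x)" if x: "x \<in> Obj K" for x
      using rep_idt[OF x] arr.rep_in_orbit[OF category_idtD(1)[OF category x]] by (simp add: sel)
    note D = category_arrD[OF category m(1)]
    note S = category_idtD[OF category D(1)] and T = category_idtD[OF category D(2)]
    show ?thesis
      using orbit_category_Cmp[OF S(1) idt[OF D(1)] m(1) arr.orbit_refl[OF m(1)]]
        orbit_category_Cmp[OF m(1) arr.orbit_refl[OF m(1)] T(1) idt[OF D(2)]] D S T m(2)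
      by (simp add: sel)
  qed
  have assoc: "Cmp ?L n (Cmp ?L m l) = Cmp ?L (Cmp ?L n m) l"
    if L: "l \<in> Arr ?L" "m \<in> Arr ?L" "n \<in> Arr ?L" "Src ?L m = Tgt ?L l" "Src ?L n = Tgt ?L m"
    for l m n
  proof -
    have l: "l \<in> Arr K" using L(1) by (rule orbit_category_ArrE)
    obtain m' where m': "m' \<in> Arr K" "m \<in> arr.orbit m'" "m' \<in> arr.orbit m" "Src K m' = Tgt K l"
      using orbit_category_composable[OF l L(2,4)] .
    have "Src ?L n = Tgt ?L m'" using L(5) rep_tgt[OF m'(1,2)] by (simp add: sel)
    then obtain n' where n': "n' \<in> Arr K" "n \<in> arr.orbit n'" "Src K n' = Tgt K m'"
      using orbit_category_composable[OF m'(1) L(3)] by metis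
    note ml = category_cmpD[OF category l m'(1,4)] and nm = category_cmpD[OF category m'(1) n'(1,3)]
    have "Cmp ?L n (Cmp ?L m l) = Cmp ?L n (arr.rep (Cmp K m' l))"
      using orbit_category_Cmp[OF l arr.orbit_refl[OF l] m'(1,2,4)] by simp
    also have "\<dots> = arr.rep (Cmp K n' (Cmp K m' l))"
      using orbit_category_Cmp[OF ml(1) arr.rep_in_orbit[OF ml(1)] n'(1,2)] ml n' by simp
    also have "\<dots> = arr.rep (Cmp K (Cmp K n' m') l)"
      using category_assoc[OF category l m'(1) n'(1)] m' n' by simp
    also have "\<dots> = Cmp ?L (arr.rep (Cmp K n' m')) l"
      using orbit_category_Cmp[OF l arr.orbit_refl[OF l] nm(1) arr.rep_in_orbit[OF nm(1)]] nm m' by simp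
    also have "\<dots> = Cmp ?L (Cmp ?L n m) l"
      using orbit_category_Cmp[OF m'(1,2) n'(1,2,3)] by simp
    finally show ?thesis .
  qed
  show ?thesis
    unfolding is_category_def
    by (intro conjI ballI impI) (simp_all only: sides idts comps units assoc)
qed

lemma orbit_cocone: "invariant_cocone G K A orbit_category orbit_functor"
proof -
  have "is_functor K orbit_category orbit_functor"
    unfolding is_functor_def
  proof (intro conjI ballI impI)
    fix x assume x: "x \<in> Obj K"
    then show "Fobj orbit_functor x \<in> Obj orbit_category"
      by (simp add: orbit_functor_def orbit_category_def)
    show "Farr orbit_functor (Idt K x) = Idt orbit_category (Fobj orbit_functor x)"
      using rep_idt[OF x] by (simp add: orbit_functor_def orbit_category_def)
  next
    fix m assume m: "m \<in> Arr K"
    show "Farr orbit_functor m \<in> Arr orbit_category"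
      "Src orbit_category (Farr orbit_functor m) = Fobj orbit_functor (Src K m)"
      "Tgt orbit_category (Farr orbit_functor m) = Fobj orbit_functor (Tgt K m)"
      using m rep_src[OF m arr.rep_in_orbit[OF m]] rep_tgt[OF m arr.rep_in_orbit[OF m]]
      by (simp_all add: orbit_functor_def orbit_category_def)
    fix n assume n: "n \<in> Arr K" "Src K n = Tgt K m"
    show "Farr orbit_functor (Cmp K n m)
        = Cmp orbit_category (Farr orbit_functor n) (Farr orbit_functor m)"
      using orbit_category_Cmp[OF m arr.rep_in_orbit[OF m] n(1) arr.rep_in_orbit[OF n(1)] n(2)]
      by (simp add: orbit_functor_def)
  qed
  then show ?thesis
    using category_orbit_category obj.rep_invariant arr.rep_invariant
    by (simp add: invariant_cocone_def functor_eq_def comp_functor_def orbit_functor_def)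
qed

text \<open>A functor on \<open>K\<close> that is constant on orbits is, by restriction to the representatives, also
  a functor on the orbit category.\<close>

lemma cocone_functor_orbit_category:
  assumes cone: "invariant_cocone G K A L F"
  shows "is_functor orbit_category L F"
    and "functor_eq K (comp_functor F orbit_functor) F"
proof -
  have F: "is_functor K L F" using cone by (simp add: invariant_cocone_def)
  have inv: "Fobj F (Fobj (A g) x) = Fobj F x" "Farr F (Farr (A g) m) = Farr F m"
    if "g \<in> carrier G" "x \<in> Obj K" "m \<in> Arr K" for g x m
    using cone that by (auto simp: invariant_cocone_def functor_eq_def comp_functor_def)
  have repo: "Fobj F (obj.rep x) = Fobj F x" if x: "x \<in> Obj K" for x
    using obj.rep_act[OF x] inv(1)[OF _ x category_idtD(1)[OF category x]] by auto
  have repa: "Farr F (arr.rep m) = Farr F m" if m: "m \<in> Arr K" for m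
    using arr.rep_act[OF m] inv(2)[OF _ category_arrD(1)[OF category m] m] by auto
  show "functor_eq K (comp_functor F orbit_functor) F"
    using repo repa by (simp add: functor_eq_def comp_functor_def orbit_functor_def)
  show "is_functor orbit_category L F"
    unfolding is_functor_def
  proof (intro conjI ballI impI)
    fix x assume "x \<in> Obj orbit_category"
    then have x: "x \<in> Obj K" by (rule orbit_category_ObjE)
    then show "Fobj F x \<in> Obj L" using functorD(1)[OF F] by simp
    show "Farr F (Idt orbit_category x) = Idt L (Fobj F x)"
      using repa category_idtD(1)[OF category x] functorD(5)[OF F x]
      by (simp add: orbit_category_def)
  next
    fix m assume "m \<in> Arr orbit_category"
    then have m: "m \<in> Arr K" by (rule orbit_category_ArrE)
    then show "Farr F m \<in> Arr L" "Src L (Farr F m) = Fobj F (Src orbit_category m)"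
      "Tgt L (Farr F m) = Fobj F (Tgt orbit_category m)"
      using functorD[OF F] repo category_arrD[OF category m] by (auto simp: orbit_category_def)
    fix n assume n: "n \<in> Arr orbit_category" "Src orbit_category n = Tgt orbit_category m"
    obtain n' where n': "n' \<in> Arr K" "n \<in> arr.orbit n'" "Src K n' = Tgt K m"
      using orbit_category_composable[OF m n] by metis
    have "Farr F n = Farr F n'"
      using n'(2) inv(2)[OF _ category_arrD(1)[OF category n'(1)] n'(1)]
      by (auto simp: arr.orbit_def)
    then show "Farr F (Cmp orbit_category n m) = Cmp L (Farr F n) (Farr F m)"
      using orbit_category_Cmp[OF m arr.orbit_refl[OF m] n'] repa
        category_cmpD(1)[OF category m n'(1,3)] functorD(6)[OF F m n'(1,3)] by simp
  qed
qed

end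

section \<open>Simplices of the quotient\<close>

locale quotient_category = condition_C_category G K A
  for G :: "('g, 'b) monoid_scheme" (structure)
    and K :: "('o, 'm) cat" and A :: "'g \<Rightarrow> ('o, 'm, 'o, 'm) cfunctor" +
  fixes Q :: "('o, 'm) cat" and P :: "('o, 'm, 'o, 'm) cfunctor"
  assumes quotient: "is_quotient G K A Q P"
begin

lemma quotient_cocone: "invariant_cocone G K A Q P"
  using quotient by (simp add: is_quotient_def)

lemma category_quotient: "is_category Q" and functor_quotient: "is_functor K Q P"
  using quotient_cocone by (simp_all add: invariant_cocone_def)

lemma quotient_act:
  assumes "g \<in> carrier G"
  shows "x \<in> Obj K \<Longrightarrow> Fobj P (Fobj (A g) x) = Fobj P x"
    and "m \<in> Arr K \<Longrightarrow> Farr P (Farr (A g) m) = Farr P m"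
  using quotient_cocone assms by (auto simp: invariant_cocone_def functor_eq_def comp_functor_def)

text \<open>The universal property, applied to the orbit category, gives \<open>H\<close>. As \<open>P\<close> is also a
  functor on the orbit category, the uniqueness clause forces \<open>P \<circ> H\<close> to be the identity of
  \<open>Q\<close>.\<close>

lemma quotient_comparison:
  obtains H where "is_functor Q orbit_category H"
    and "functor_eq K (comp_functor H P) orbit_functor"
    and "functor_eq Q (comp_functor P H) id_functor"
proof -
  obtain H where H: "is_functor Q orbit_category H"
      "functor_eq K (comp_functor H P) orbit_functor"
    using quotient orbit_cocone unfolding is_quotient_def by blast
  obtain U where U: "\<And>H'. is_functor Q Q H' \<Longrightarrow> functor_eq K (comp_functor H' P) P \<Longrightarrow>
      functor_eq Q H' U"
    using quotient unfolding is_quotient_def by blast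
  note J = cocone_functor_orbit_category[OF quotient_cocone]
  have "functor_eq Q (comp_functor P H) U"
  proof (rule U)
    show "is_functor Q Q (comp_functor P H)"
      using H(1) J(1) by (simp add: is_functor_def comp_functor_def)
    show "functor_eq K (comp_functor (comp_functor P H) P) P"
      using H(2) J(2) by (simp add: functor_eq_def comp_functor_def)
  qed
  moreover have "functor_eq Q id_functor U"
    by (rule U) (simp_all add: is_functor_def functor_eq_def comp_functor_def id_functor_def)
  ultimately have "functor_eq Q (comp_functor P H) id_functor" by (simp add: functor_eq_def)
  with H show thesis by (rule that)
qed

lemma quotient_obj_eq_iff:
  assumes "x \<in> Obj K" "y \<in> Obj K"
  shows "Fobj P x = Fobj P y \<longleftrightarrow> obj.orbit x = obj.orbit y"
proof
  assume eq: "Fobj P x = Fobj P y"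
  obtain H where "functor_eq K (comp_functor H P) orbit_functor" using quotient_comparison by metis
  from functor_eqD(1)[OF this] assms eq have "obj.rep x = obj.rep y"
    by (metis comp_functor_def orbit_functor_def cfunctor.select_convs(1) comp_apply)
  then show "obj.orbit x = obj.orbit y" using assms by (simp add: obj.rep_eq_iff)
qed (use assms quotient_act(1) in \<open>auto simp: obj.orbit_eq_iff\<close>)

lemma quotient_arr_eq_iff:
  assumes "m \<in> Arr K" "n \<in> Arr K"
  shows "Farr P m = Farr P n \<longleftrightarrow> arr.orbit m = arr.orbit n"
proof
  assume eq: "Farr P m = Farr P n"
  obtain H where "functor_eq K (comp_functor H P) orbit_functor" using quotient_comparison by metis
  from functor_eqD(2)[OF this] assms eq have "arr.rep m = arr.rep n"
    by (metis comp_functor_def orbit_functor_def cfunctor.select_convs(2) comp_apply)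
  then show "arr.orbit m = arr.orbit n" using assms by (simp add: arr.rep_eq_iff)
qed (use assms quotient_act(2) in \<open>auto simp: arr.orbit_eq_iff\<close>)

lemma quotient_surj: "Fobj P ` Obj K = Obj Q" "Farr P ` Arr K = Arr Q"
proof -
  obtain H where H: "is_functor Q orbit_category H" "functor_eq Q (comp_functor P H) id_functor"
    using quotient_comparison by metis
  have "Fobj H q \<in> Obj K \<and> Fobj P (Fobj H q) = q" if "q \<in> Obj Q" for q
    using functorD(1)[OF H(1) that] functor_eqD(1)[OF H(2) that]
    by (auto simp: comp_functor_def id_functor_def elim: orbit_category_ObjE)
  moreover have "Farr H a \<in> Arr K \<and> Farr P (Farr H a) = a" if "a \<in> Arr Q" for a
    using functorD(2)[OF H(1) that] functor_eqD(2)[OF H(2) that]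
    by (auto simp: comp_functor_def id_functor_def elim: orbit_category_ArrE)
  ultimately show "Fobj P ` Obj K = Obj Q" "Farr P ` Arr K = Arr Q"
    using functorD(1,2)[OF functor_quotient] by (auto intro!: image_eqI)
qed

lemma identity_quotient_iff:
  assumes m: "m \<in> Arr K"
  shows "Farr P m \<in> Idt Q ` Obj Q \<longleftrightarrow> m \<in> Idt K ` Obj K"
proof
  assume "Farr P m \<in> Idt Q ` Obj Q"
  then obtain x where x: "x \<in> Obj K" "Farr P m = Farr P (Idt K x)"
    using functorD(5)[OF functor_quotient] by (auto simp: quotient_surj(1)[symmetric])
  then obtain g where "g \<in> carrier G" "Farr (A g) m = Idt K x"
    using m category_idtD(1)[OF category x(1)] by (auto simp: quotient_arr_eq_iff arr.orbit_eq_iff)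
  then show "m \<in> Idt K ` Obj K" using identity_act_iff[OF _ m] x(1) by force
qed (use functorD(1,5)[OF functor_quotient] in auto)

text \<open>Every chain of the quotient lifts, starting at any prescribed preimage of its initial
  vertex.\<close>

lemma composable_from_lift:
  "composable_from Q q qs \<Longrightarrow> x \<in> Obj K \<Longrightarrow> Fobj P x = q \<Longrightarrow>
     \<exists>ms. composable_from K x ms \<and> map (Farr P) ms = qs"
proof (induction qs arbitrary: q x)
  case Nil
  then show ?case by (intro exI[of _ "[]"]) simp
next
  case (Cons a qs)
  from Cons.prems obtain m where m: "m \<in> Arr K" "a = Farr P m"
    using quotient_surj(2) by auto
  have "Fobj P (Src K m) = Fobj P x"
    using Cons.prems m functorD(3)[OF functor_quotient m(1)] by simp
  then obtain g where g: "g \<in> carrier G" "Fobj (A g) (Src K m) = x"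
    using Cons.prems(2) category_arrD(1)[OF category m(1)]
    by (auto simp: quotient_obj_eq_iff obj.orbit_eq_iff)
  let ?n = "Farr (A g) m"
  have n: "?n \<in> Arr K" "Src K ?n = x" "Farr P ?n = a"
    using m g quotient_act(2)[OF g(1) m(1)] by (auto simp: actD)
  have "Fobj P (Tgt K ?n) = Tgt Q a" using functorD(4)[OF functor_quotient n(1)] n(3) by simp
  then obtain ms where "composable_from K (Tgt K ?n) ms" "map (Farr P) ms = qs"
    using Cons.IH[of "Tgt Q a" "Tgt K ?n"] Cons.prems(1) category_arrD(2)[OF category n(1)] by auto
  with n Cons.prems(2) show ?case by (intro exI[of _ "?n # ms"]) simp
qed

text \<open>Two chains with the same image in the quotient lie in one orbit. A group element carrying
  the first onto the second is built up one morphism at a time, from the start of the chain: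
  Condition (C) corrects the last morphism without disturbing the ones already matched.\<close>

lemma chain_same_image_orbit:
  "composable_from K x ms \<Longrightarrow> composable_from K y ns \<Longrightarrow> Fobj P x = Fobj P y \<Longrightarrow>
     map (Farr P) ms = map (Farr P) ns \<Longrightarrow>
     \<exists>g\<in>carrier G. Fobj (A g) x = y \<and> map (Farr (A g)) ms = ns"
proof (induction ms arbitrary: ns rule: rev_induct)
  case Nil
  then show ?case by (auto simp: quotient_obj_eq_iff obj.orbit_eq_iff)
next
  case (snoc a ms)
  obtain ns' b where ns: "ns = ns' @ [b]" "map (Farr P) ms = map (Farr P) ns'" "Farr P a = Farr P b"
    using snoc.prems(4) by (cases ns rule: rev_cases) auto
  have c: "composable_from K x ms" "a \<in> Arr K" "Src K a = vertex K (length ms) (x, ms)"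
    "composable_from K y ns'" "b \<in> Arr K" "Src K b = vertex K (length ns') (y, ns')"
    using snoc.prems(1,2) by (auto simp: ns(1) composable_from_append)
  have orb: "arr.orbit a = arr.orbit b" using c ns(3) by (simp add: quotient_arr_eq_iff)
  \<comment> \<open>Condition (C) needs at least one morphism before \<open>a\<close> and \<open>b\<close>\<close>
  show ?case
  proof (cases "ns' = []")
    case True
    obtain g where g: "g \<in> carrier G" "Farr (A g) a = b"
      using orb c by (auto simp: arr.orbit_eq_iff)
    have "Fobj (A g) x = y"
      using True ns(2) c g actD(3)[OF g(1) c(2)] by (auto simp: vertex_def)
    with True ns g show ?thesis by auto
  next
    case False
    obtain g where g: "g \<in> carrier G" "Fobj (A g) x = y" "map (Farr (A g)) ms = ns'"
      using snoc.IH[OF c(1,4) snoc.prems(3) ns(2)] by auto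
    have "vertex K (length ns') (y, ns') = Fobj (A g) (vertex K (length ms) (x, ms))"
    proof (cases "length ms")
      case (Suc k)
      then have "ms ! k \<in> Arr K" using composable_from_arr[OF c(1)] by simp
      then show ?thesis using Suc g by (auto simp: vertex_def actD)
    qed (use g in \<open>auto simp: vertex_def\<close>)
    then have "Src K (Farr (A g) a) = vertex K (length ns') (y, ns')"
      using c g by (simp add: actD)
    then obtain h where h: "h \<in> carrier G" "Farr (A h) (Farr (A g) a) = b"
        "map (Farr (A h)) ns' = ns'"
      using condition_C_list[OF c(4) False _ _ c(5,6), of "Farr (A g) a"] c(2) g(1) orb
      by (auto simp: arr.closed arr.orbit_act)
    have "Fobj (A h) y = y"
    proof -
      from False have n0: "ns' ! 0 \<in> Arr K" "Src K (ns' ! 0) = y"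
        using composable_from_arr[OF c(4)] composable_from_nth[OF c(4), of 0]
        by (auto simp: vertex_def)
      moreover have "Farr (A h) (ns' ! 0) = ns' ! 0"
        using h(3) False by (metis length_greater_0_conv nth_map)
      ultimately show ?thesis using actD(3)[OF h(1) n0(1)] by simp
    qed
    then have "Fobj (A (h \<otimes> g)) x = y"
      using g h obj.act_mult composable_from_obj[OF c(1)] by simp
    moreover have "Farr (A (h \<otimes> g)) m = Farr (A h) (Farr (A g) m)" if "m \<in> Arr K" for m
      using that g h by (simp add: arr.act_mult)
    then have "map (Farr (A (h \<otimes> g))) (ms @ [a]) = map (Farr (A h)) (map (Farr (A g)) (ms @ [a]))"
      using composable_from_arr[OF c(1)] c(2) by simp
    then have "map (Farr (A (h \<otimes> g))) (ms @ [a]) = ns" using g h ns(1) by simp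
    ultimately show ?thesis using g h by blast
  qed
qed

lemma proper_chains_quotient: "proper_chains Q = simplex_map P ` proper_chains K"
proof -
  have id: "set (map (Farr P) ms) \<inter> Idt Q ` Obj Q = {} \<longleftrightarrow> set ms \<inter> Idt K ` Obj K = {}"
    if "composable_from K x ms" for x ms
    using identity_quotient_iff composable_from_arr[OF that] by (auto simp: disjoint_iff)
  show ?thesis
  proof (intro equalityI subsetI)
    fix \<tau> assume \<tau>: "\<tau> \<in> proper_chains Q"
    obtain q qs where [simp]: "\<tau> = (q, qs)" by (cases \<tau>)
    have q: "composable_from Q q qs" "set qs \<inter> Idt Q ` Obj Q = {}"
      using \<tau> by (auto simp: proper_chains_def)
    have "q \<in> Fobj P ` Obj K" using composable_from_obj[OF q(1)] by (simp add: quotient_surj(1))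
    then obtain x where x: "x \<in> Obj K" "Fobj P x = q" by auto
    then obtain ms where ms: "composable_from K x ms" "map (Farr P) ms = qs"
      using composable_from_lift[OF q(1)] by blast
    then have "(x, ms) \<in> proper_chains K" using id[OF ms(1)] q(2) by (simp add: proper_chains_def)
    moreover have "\<tau> = simplex_map P (x, ms)" using x ms by (simp add: simplex_map_def)
    ultimately show "\<tau> \<in> simplex_map P ` proper_chains K" by (rule rev_image_eqI)
  next
    fix \<tau> assume "\<tau> \<in> simplex_map P ` proper_chains K"
    then obtain x ms where "composable_from K x ms" "set ms \<inter> Idt K ` Obj K = {}"
      "\<tau> = (Fobj P x, map (Farr P) ms)" by (auto simp: proper_chains_def simplex_map_def)
    then show "\<tau> \<in> proper_chains Q"
      using id composable_from_functor[OF functor_quotient] by (auto simp: proper_chains_def)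
  qed
qed

lemma simplex_map_quotient_eq_iff:
  assumes "\<sigma> \<in> proper_chains K" "\<tau> \<in> proper_chains K"
  shows "simplex_map P \<sigma> = simplex_map P \<tau> \<longleftrightarrow> (\<exists>g\<in>carrier G. simplex_map (A g) \<sigma> = \<tau>)"
proof
  assume "simplex_map P \<sigma> = simplex_map P \<tau>"
  then show "\<exists>g\<in>carrier G. simplex_map (A g) \<sigma> = \<tau>"
    using chain_same_image_orbit[of "fst \<sigma>" "snd \<sigma>" "fst \<tau>" "snd \<tau>"] assms
    by (auto simp: proper_chains_def simplex_map_def)
next
  assume "\<exists>g\<in>carrier G. simplex_map (A g) \<sigma> = \<tau>"
  then show "simplex_map P \<sigma> = simplex_map P \<tau>"
    using assms(1) quotient_act composable_from_obj[of K "fst \<sigma>" "snd \<sigma>"]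
      composable_from_arr[of K "fst \<sigma>" "snd \<sigma>"]
    by (auto simp: proper_chains_def simplex_map_def)
qed

end

section \<open>Averaging the Moebius function\<close>

theorem proposition4p4:
  fixes G :: "('g, 'b) monoid_scheme"
    and K Q :: "('o, 'm) cat"
    and A :: "'g \<Rightarrow> ('o, 'm, 'o, 'm) cfunctor"
    and P :: "('o, 'm, 'o, 'm) cfunctor"
  assumes "finite_category K" and "loopfree K"
    and "group G" and "finite (carrier G)"
    and "category_action G K A"
    and "condition_C G K A"
    and "is_quotient G K A Q P"
  shows "finite_nerve Q \<and> (\<forall>g\<in>carrier G. finite_nerve (fixed_subcategory K (A g))) \<and>
    (of_int (moebius Q) :: rat) =
      1 / of_nat (card (carrier G)) * (\<Sum>g\<in>carrier G. of_int (moebius (fixed_subcategory K (A g))))"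
proof -
  interpret group G by fact
  interpret quotient_category G K A Q P
    using assms by unfold_locales (simp_all add: finite_category_def)
  let ?S = "proper_chains K"
  let ?Fix = "\<lambda>g. fixed_subcategory K (A g)"
  let ?w = "\<lambda>n. (- 1 :: rat) ^ n"
  have fin: "finite ?S" by (rule finite_proper_chains) fact+
  have finQ: "finite_nerve Q"
    using fin by (simp add: finite_nerve_def Union_nondegenerate[OF category_quotient]
        proper_chains_quotient)
  have finF: "finite_nerve (?Fix g)" if "g \<in> carrier G" for g
    using fin that
    by (simp add: finite_nerve_def Union_nondegenerate category_fixed proper_chains_fixed)
  have mQ: "of_int (moebius Q) = (\<Sum>\<tau>\<in>simplex_map P ` ?S. ?w (length (snd \<tau>))) - 1"
    by (simp add: moebius_def euler_char_def Union_nondegenerate[OF category_quotient]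
        proper_chains_quotient)
  have mF: "of_int (moebius (?Fix g))
      = (\<Sum>\<sigma>\<in>{\<sigma>\<in>?S. simplex_map (A g) \<sigma> = \<sigma>}. ?w (length (snd \<sigma>))) - 1"
    if "g \<in> carrier G" for g
    using that by (simp add: moebius_def euler_char_def Union_nondegenerate category_fixed
        proper_chains_fixed)
  have pos: "(of_nat (card (carrier G)) :: rat) \<noteq> 0"
    using assms(4) by (simp add: card_eq_0_iff) (use one_closed in blast)
  have "of_nat (card (carrier G)) * (\<Sum>\<tau>\<in>simplex_map P ` ?S. ?w (length (snd \<tau>)))
      = (\<Sum>g\<in>carrier G. \<Sum>\<sigma>\<in>{\<sigma>\<in>?S. simplex_map (A g) \<sigma> = \<sigma>}.
          ?w (length (snd (simplex_map P \<sigma>))))"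
    by (rule chains.weighted_burnside[OF assms(4) fin simplex_map_quotient_eq_iff])
  also have "\<dots> = (\<Sum>g\<in>carrier G. of_int (moebius (?Fix g)) + 1)"
    using mF by (simp add: simplex_map_def)
  also have "\<dots> = (\<Sum>g\<in>carrier G. of_int (moebius (?Fix g))) + of_nat (card (carrier G))"
    by (simp add: sum.distrib)
  finally have "of_nat (card (carrier G)) * of_int (moebius Q)
      = (\<Sum>g\<in>carrier G. of_int (moebius (?Fix g)) :: rat)"
    by (simp add: mQ algebra_simps)
  with pos have "of_int (moebius Q)
      = 1 / of_nat (card (carrier G)) * (\<Sum>g\<in>carrier G. of_int (moebius (?Fix g)) :: rat)"
    by (simp add: field_simps)
  with finQ finF show ?thesis by blast
qed

end
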